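(* Let $n\ge 1$, $T>0$, let $X\subset\mathbb{R}^n$ be open and let $f: X\times(0,T)\to\mathbb{R}^n$ be a map of class $C^2$. If $f$ satisfies the transversality conditions (i.e. (T1), (T2), (T3) hold at every point of its singular set $\mathcal S$), then for every $t\in(0,T)$ the set $\mathcal C(t)=\{x\in X: f(x,t)=0\}$ consists only of isolated points.
   Context: Notation: $\langle\cdot,\cdot\rangle$ is the scalar product of $\mathbb{R}^n$; for a linear map $K$, $\mathsf N(K)$ denotes its null space and $K^*$ its transpose; $D_x f$, $D_x^2 f$ are the first and second partial differentials with respect to $x\in\mathbb{R}^n$ and $\partial_t f$ is the partial derivative in $t\in(0,T)$. Define $\mathcal C:=\{(x,t)\in X\times(0,T): f(x,t)=0\}$ and $\mathcal S:=\{(x,t)\in\mathcal C: D_xf(x,t)\text{ is not invertible}\}$. Transversality conditions at a point $(x_0,t_0)\in\mathcal S$: (T1) $\dim \mathsf N(D_xf(x_0,t_0))=1$ (and therefore $\dim \mathsf N(D_xf(x_0,t_0)^* )=1$); (T2) if $0\neq w^*\in \mathsf N(D_xf(x_0,t_0)^* )$, then $\langle\partial_t f(x_0,t_0),w^*\rangle\neq0$; (T3) if $0\neq v\in \mathsf N(D_xf(x_0,t_0))$ and $0\ne w^*\in \mathsf N(D_xf(x_0,t_0)^* )$, then $\langle D_x^2f(x_0,t_0)[v,v],w^*\rangle\neq0$. $f$ satisfies the transversality conditions if they hold at every point of $\mathcal S$. *)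

theory Defs
  imports "HOL-Analysis.Analysis"
begin

text \<open>
  A map with domain \<open>X \<times> (0,T)\<close> is represented by a total function of a pair, and only its
  values on \<open>X \<times> {0<..<T}\<close> matter: the predicate \<open>C2_on\<close> below is used for open \<open>S\<close>, where
  the derivative \<open>at z\<close> does not depend on the values outside \<open>S\<close>.
\<close>

definition C2_on :: "('a::real_normed_vector \<Rightarrow> 'b::real_normed_vector) \<Rightarrow> 'a set \<Rightarrow> bool" where
  "C2_on f S \<longleftrightarrow>
     (\<exists>(f' :: 'a \<Rightarrow> 'a \<Rightarrow>\<^sub>L 'b) (f'' :: 'a \<Rightarrow> 'a \<Rightarrow>\<^sub>L ('a \<Rightarrow>\<^sub>L 'b)).
        (\<forall>z\<in>S. (f has_derivative blinfun_apply (f' z)) (at z)) \<and>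
        (\<forall>z\<in>S. (f' has_derivative blinfun_apply (f'' z)) (at z)) \<and>
        continuous_on S f'')"

definition Dx :: "('a::real_normed_vector \<times> real \<Rightarrow> 'b::real_normed_vector) \<Rightarrow> 'a \<times> real \<Rightarrow> 'a \<Rightarrow> 'b" where
  "Dx f p = frechet_derivative (\<lambda>x. f (x, snd p)) (at (fst p))"

text \<open>
  The map \<open>x \<mapsto> Dx f (x, t)\<close> is differentiated as a map into the normed space of bounded linear
  operators; \<open>Blinfun\<close> packs a bounded linear function as an element of that space.
\<close>

definition D2x :: "('a::real_normed_vector \<times> real \<Rightarrow> 'b::real_normed_vector) \<Rightarrow> 'a \<times> real \<Rightarrow> 'a \<Rightarrow> 'a \<Rightarrow> 'b" where
  "D2x f p v w =
     blinfun_apply (frechet_derivative (\<lambda>x. Blinfun (Dx f (x, snd p))) (at (fst p)) v) w"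

definition Dt :: "('a \<times> real \<Rightarrow> 'b::real_normed_vector) \<Rightarrow> 'a \<times> real \<Rightarrow> 'b" where
  "Dt f p = vector_derivative (\<lambda>s. f (fst p, s)) (at (snd p))"

definition null_space :: "('a \<Rightarrow> 'b::zero) \<Rightarrow> 'a set" where
  "null_space K = {v. K v = 0}"

definition zero_set :: "('a \<times> real \<Rightarrow> 'b::zero) \<Rightarrow> 'a set \<Rightarrow> real \<Rightarrow> ('a \<times> real) set" where
  "zero_set f X T = {p \<in> X \<times> {0<..<T}. f p = 0}"

definition zero_slice :: "('a \<times> real \<Rightarrow> 'b::zero) \<Rightarrow> 'a set \<Rightarrow> real \<Rightarrow> 'a set" where
  "zero_slice f X t = {x \<in> X. f (x, t) = 0}"

definition singular_set ::
    "('a::real_normed_vector \<times> real \<Rightarrow> 'b::real_normed_vector) \<Rightarrow> 'a set \<Rightarrow> real \<Rightarrow> ('a \<times> real) set" where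
  "singular_set f X T = {p \<in> zero_set f X T. \<not> bij (Dx f p)}"

definition transversal_T1 :: "('a::euclidean_space \<times> real \<Rightarrow> 'a) \<Rightarrow> 'a \<times> real \<Rightarrow> bool" where
  "transversal_T1 f p \<longleftrightarrow> dim (null_space (Dx f p)) = 1"

definition transversal_T2 :: "('a::euclidean_space \<times> real \<Rightarrow> 'a) \<Rightarrow> 'a \<times> real \<Rightarrow> bool" where
  "transversal_T2 f p \<longleftrightarrow>
     (\<forall>w \<in> null_space (adjoint (Dx f p)). w \<noteq> 0 \<longrightarrow> Dt f p \<bullet> w \<noteq> 0)"

definition transversal_T3 :: "('a::euclidean_space \<times> real \<Rightarrow> 'a) \<Rightarrow> 'a \<times> real \<Rightarrow> bool" where
  "transversal_T3 f p \<longleftrightarrow>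
     (\<forall>v \<in> null_space (Dx f p). \<forall>w \<in> null_space (adjoint (Dx f p)).
        v \<noteq> 0 \<longrightarrow> w \<noteq> 0 \<longrightarrow> D2x f p v v \<bullet> w \<noteq> 0)"

definition transversality :: "('a::euclidean_space \<times> real \<Rightarrow> 'a) \<Rightarrow> 'a set \<Rightarrow> real \<Rightarrow> bool" where
  "transversality f X T \<longleftrightarrow>
     (\<forall>p \<in> singular_set f X T. transversal_T1 f p \<and> transversal_T2 f p \<and> transversal_T3 f p)"

end

theory Submission
  imports Defs
begin

text \<open>
  Suppose zeros \<open>x\<^sub>k \<noteq> x\<close> of \<open>g = f (\<cdot>, t)\<close> converge to the zero \<open>x\<close>. Along a subsequence
  the directions \<open>(x\<^sub>k - x) / \<parallel>x\<^sub>k - x\<parallel>\<close> converge to a unit vector \<open>u\<close>, and the first-order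
  expansion gives \<open>Dg(x) u = 0\<close>; hence \<open>Dg(x)\<close> is singular and some \<open>w \<noteq> 0\<close> is orthogonal to its
  range. By Rolle's theorem for \<open>\<langle>g, w\<rangle>\<close> on the segment from \<open>x\<close> to \<open>x\<^sub>k\<close>, the functional
  \<open>\<langle>Dg(y\<^sub>k) \<cdot>, w\<rangle>\<close> vanishes at \<open>x\<^sub>k - x\<close> for some \<open>y\<^sub>k\<close> inside the segment. Since \<open>y\<^sub>k\<close> approaches
  \<open>x\<close> from the same directions, in the limit \<open>\<langle>D\<^sup>2g(x)[u, u], w\<rangle> = 0\<close>, contradicting (T3).
\<close>

text \<open>The remainder is o(norm (h k)), and \<open>D\<close> is continuous along the normalized
  increments. The codomain is a general normed space because the lemma is applied both to a map and
  to its operator-valued derivative.\<close>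

lemma has_derivative_directional_limit:
  fixes F :: "'a::real_normed_vector \<Rightarrow> 'b::real_normed_vector"
  assumes F: "(F has_derivative D) (at x)"
    and h: "h \<longlonglongrightarrow> 0" "\<And>k. h k \<noteq> 0"
    and u: "(\<lambda>k. h k /\<^sub>R norm (h k)) \<longlonglongrightarrow> u"
  shows "(\<lambda>k. (F (x + h k) - F x) /\<^sub>R norm (h k)) \<longlonglongrightarrow> D u"
proof -
  have bl: "bounded_linear D"
    using F by (rule has_derivative_bounded_linear)
  have "((\<lambda>y. norm (F (x + y) - F x - D y) / norm y) \<longlongrightarrow> 0) (at 0)"
    using F by (simp add: has_derivative_at)
  moreover have "filterlim h (at 0) sequentially"
    using h by (simp add: filterlim_at)
  ultimately have "(\<lambda>k. norm (F (x + h k) - F x - D (h k)) / norm (h k)) \<longlonglongrightarrow> 0"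
    by (rule filterlim_compose)
  then have "(\<lambda>k. norm ((F (x + h k) - F x - D (h k)) /\<^sub>R norm (h k))) \<longlonglongrightarrow> 0"
    by (simp add: divide_inverse mult.commute)
  then have "(\<lambda>k. (F (x + h k) - F x - D (h k)) /\<^sub>R norm (h k)) \<longlonglongrightarrow> 0"
    by (rule tendsto_norm_zero_cancel)
  moreover have "(\<lambda>k. D (h k /\<^sub>R norm (h k))) \<longlonglongrightarrow> D u"
    using bl u by (rule bounded_linear.tendsto)
  ultimately have "(\<lambda>k. (F (x + h k) - F x - D (h k)) /\<^sub>R norm (h k)
      + D (h k /\<^sub>R norm (h k))) \<longlonglongrightarrow> 0 + D u"
    by (rule tendsto_add)
  then show ?thesis
    by (simp add: linear_scale[OF bounded_linear.linear[OF bl]] scaleR_diff_right)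
qed

text \<open>Between spaces of equal finite dimension a non-injective linear map is not surjective,
  so its range is a proper subspace and has a nonzero normal vector.\<close>

lemma exists_orthogonal_to_range_if_not_inj:
  fixes A :: "'a::euclidean_space \<Rightarrow> 'a"
  assumes "linear A" "\<not> inj A"
  obtains w where "w \<noteq> 0" "\<And>y. A y \<bullet> w = 0"
proof -
  have "\<not> surj A"
    using assms linear_surjective_imp_injective by blast
  moreover have "span (range A) = range A"
    by (metis assms(1) linear_subspace_image span_eq_iff subspace_UNIV)
  ultimately have "span (range A) \<subset> span UNIV"
    by (metis psubsetI span_UNIV subset_UNIV)
  then obtain w where "w \<noteq> 0" "\<And>y. y \<in> span (range A) \<Longrightarrow> orthogonal w y"
    using orthogonal_to_subspace_exists_gen[of "range A" UNIV] by blast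
  then show ?thesis
    using that[of w] by (metis inner_commute orthogonal_def rangeI span_base)
qed

text \<open>Orthogonality to the range of \<open>g' x\<close> stands for membership in the kernel of
  its transpose. Nondegeneracy holds vacuously when \<open>g' x\<close> is injective, so regular and
  singular zeros are treated together.\<close>

lemma isolated_zero_if_nondegenerate:
  fixes g :: "'a::euclidean_space \<Rightarrow> 'a" and g' :: "'a \<Rightarrow> 'a \<Rightarrow>\<^sub>L 'a"
  assumes "open X" "x \<in> X" "g x = 0"
    and g: "\<And>y. y \<in> X \<Longrightarrow> (g has_derivative blinfun_apply (g' y)) (at y)"
    and g': "(g' has_derivative B) (at x)"
    and nondegenerate: "\<And>v w. \<lbrakk>g' x v = 0; v \<noteq> 0; \<And>y. g' x y \<bullet> w = 0; w \<noteq> 0\<rbrakk>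
      \<Longrightarrow> blinfun_apply (B v) v \<bullet> w \<noteq> 0"
  shows "x isolated_in {y \<in> X. g y = 0}"
proof (rule ccontr)
  assume "\<not> ?thesis"
  then have "x islimpt {y \<in> X. g y = 0}"
    using assms(2,3) by (simp add: isolated_in_islimpt_iff)
  moreover obtain e where e: "e > 0" "ball x e \<subseteq> X"
    using assms(1,2) openE by blast
  \<comment> \<open>Zeros are taken from a ball inside \<open>X\<close>, so that the segments
    joining them to \<open>x\<close> stay where \<open>g\<close> is differentiable.\<close>
  ultimately have "x islimpt {y \<in> X. g y = 0} \<inter> ball x e"
    using eventually_at_ball[of e x UNIV] by (intro islimpt_Int_eventually) simp_all
  then obtain z where z: "\<And>k. z k \<in> ball x e" "\<And>k. g (z k) = 0" "\<And>k. z k \<noteq> x" "z \<longlonglongrightarrow> x"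
    by (auto simp: islimpt_sequential)
  have "\<exists>u\<in>sphere 0 1. \<exists>r. strict_mono r \<and>
      ((\<lambda>k. (z k - x) /\<^sub>R norm (z k - x)) \<circ> r) \<longlonglongrightarrow> u"
    using compact_sphere[of "0::'a" 1] z(3) unfolding compact_def by simp
  then obtain u and r :: "nat \<Rightarrow> nat" where u: "norm u = 1" and r: "strict_mono r"
    and lim: "((\<lambda>k. (z k - x) /\<^sub>R norm (z k - x)) \<circ> r) \<longlonglongrightarrow> u"
    by auto
  define h where "h k = z (r k) - x" for k
  have h: "h k \<noteq> 0" "g (x + h k) = 0" "norm (h k) < e" for k
    using z(1-3)[of "r k"] by (auto simp: h_def dist_norm norm_minus_commute)
  have h_lim: "h \<longlonglongrightarrow> 0"
    using LIMSEQ_subseq_LIMSEQ[OF z(4) r] unfolding h_def comp_def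
    by (simp add: LIM_zero_iff)
  have u_lim: "(\<lambda>k. h k /\<^sub>R norm (h k)) \<longlonglongrightarrow> u"
    using lim by (simp add: h_def comp_def)
  have "(\<lambda>k. (g (x + h k) - g x) /\<^sub>R norm (h k)) \<longlonglongrightarrow> g' x u"
    using has_derivative_directional_limit[OF g[OF assms(2)] h_lim h(1) u_lim] .
  then have kernel: "g' x u = 0"
    using h(2) assms(3) by (simp add: LIMSEQ_const_iff)
  then have "\<not> inj (blinfun_apply (g' x))"
    using u by (metis blinfun.zero_right injD norm_zero zero_neq_one)
  then obtain w where w: "w \<noteq> 0" "\<And>y. g' x y \<bullet> w = 0"
    by (rule exists_orthogonal_to_range_if_not_inj
        [OF bounded_linear.linear[OF blinfun.bounded_linear_right]]) blast
  \<comment> \<open>Rolle's theorem needs a real-valued function, hence the projection onto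
    \<open>w\<close>, which is the same for all \<open>k\<close>.\<close>
  have "\<exists>s. 0 < s \<and> s < 1 \<and> g' (x + s *\<^sub>R h k) (h k) \<bullet> w = 0" for k
  proof -
    define \<phi> where "\<phi> s = g (x + s *\<^sub>R h k) \<bullet> w" for s
    have deriv: "(\<phi> has_real_derivative g' (x + s *\<^sub>R h k) (h k) \<bullet> w) (at s)"
      if "0 \<le> s" "s \<le> 1" for s
    proof -
      have "norm (s *\<^sub>R h k) \<le> norm (h k)"
        using that by (simp add: mult_left_le_one_le)
      then have "x + s *\<^sub>R h k \<in> ball x e"
        using h(3)[of k] by (simp add: dist_norm)
      then have "x + s *\<^sub>R h k \<in> X"
        using e(2) by blast
      then have g_deriv: "(g has_derivative g' (x + s *\<^sub>R h k)) (at (x + s *\<^sub>R h k))"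
        by (rule g)
      have "((\<lambda>s. x + s *\<^sub>R h k) has_derivative (\<lambda>d. d *\<^sub>R h k)) (at s)"
        by (auto intro!: derivative_eq_intros)
      then have "((\<lambda>s. g (x + s *\<^sub>R h k)) has_derivative
          (\<lambda>d. g' (x + s *\<^sub>R h k) (d *\<^sub>R h k))) (at s)"
        using g_deriv
        by (rule has_derivative_compose[where g = g and f = "\<lambda>s. x + s *\<^sub>R h k"])
      then have "(\<phi> has_derivative (\<lambda>d. g' (x + s *\<^sub>R h k) (d *\<^sub>R h k) \<bullet> w)) (at s)"
        unfolding \<phi>_def by (rule has_derivative_inner_left)
      then show ?thesis
        by (simp add: has_field_derivative_def blinfun.scaleR_right mult_commute_abs)
    qed
    have "\<phi> 0 = \<phi> 1"
      using h(2) assms(3) by (simp add: \<phi>_def)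
    moreover have "continuous_on {0..1} \<phi>"
      using deriv by (auto intro!: DERIV_isCont continuous_at_imp_continuous_on)
    ultimately obtain s where s: "0 < s" "s < 1" "DERIV \<phi> s :> 0"
      using Rolle[of 0 1 \<phi>] deriv real_differentiable_def
      by (metis less_imp_le zero_less_one)
    then show ?thesis
      using DERIV_unique[OF deriv[of s] s(3)] by auto
  qed
  then obtain s where s: "\<And>k. 0 < s k" "\<And>k. s k < 1"
    and rolle: "\<And>k. g' (x + s k *\<^sub>R h k) (h k) \<bullet> w = 0"
    by metis
  \<comment> \<open>Difference quotients of the derivative at the Rolle points. Since
    \<open>s k\<close> is positive, it cancels when the increment is normalized, so the limiting
    direction is again \<open>u\<close>.\<close>
  define q where "q k = (g' (x + s k *\<^sub>R h k) - g' x) /\<^sub>R norm (s k *\<^sub>R h k)" for k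
  have "(\<lambda>k. s k *\<^sub>R h k) \<longlonglongrightarrow> 0"
  proof (rule Lim_null_comparison)
    show "\<forall>\<^sub>F k in sequentially. norm (s k *\<^sub>R h k) \<le> norm (h k)"
      using s by (intro always_eventually allI) (simp add: less_imp_le mult_left_le_one_le)
    show "(\<lambda>k. norm (h k)) \<longlonglongrightarrow> 0"
      using h_lim by (rule tendsto_norm_zero)
  qed
  moreover have "s k *\<^sub>R h k \<noteq> 0" for k
    using h(1)[of k] s(1)[of k] by simp
  moreover have "(s k *\<^sub>R h k) /\<^sub>R norm (s k *\<^sub>R h k) = h k /\<^sub>R norm (h k)" for k
    using s(1)[of k] by simp
  then have "(\<lambda>k. (s k *\<^sub>R h k) /\<^sub>R norm (s k *\<^sub>R h k)) \<longlonglongrightarrow> u"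
    using u_lim by presburger
  ultimately have "q \<longlonglongrightarrow> B u"
    unfolding q_def by (rule has_derivative_directional_limit[OF g'])
  then have "(\<lambda>k. q k (h k /\<^sub>R norm (h k)) \<bullet> w) \<longlonglongrightarrow> B u u \<bullet> w"
    using u_lim by (intro tendsto_intros)
  \<comment> \<open>The term at the Rolle point vanishes by \<open>rolle\<close>, the term at
    \<open>x\<close> because \<open>w\<close> is orthogonal to the range of
    \<open>g' x\<close>.\<close>
  moreover have "q k (h k /\<^sub>R norm (h k)) \<bullet> w = 0" for k
    using rolle[of k] w(2)
    by (simp add: q_def blinfun.scaleR_left blinfun.scaleR_right blinfun.diff_left inner_diff_left)
  ultimately have "B u u \<bullet> w = 0"
    by (simp add: LIMSEQ_const_iff)
  then show False
    using nondegenerate[OF kernel _ w(2) w(1)] u by (metis norm_zero zero_neq_one)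
qed

text \<open>The partial differentials are the total ones restricted to directions
  \<open>(v, 0)\<close>, that is, composed with the embedding \<open>P\<close>. This composition is
  bounded linear in the operator, so it commutes with differentiating once more.\<close>

lemma slice_derivatives:
  fixes f :: "'a::euclidean_space \<times> real \<Rightarrow> 'b::real_normed_vector"
  assumes "open X" "t \<in> {0<..<T}" "C2_on f (X \<times> {0<..<T})"
  obtains g' where
    "\<And>x. x \<in> X \<Longrightarrow> ((\<lambda>y. f (y, t)) has_derivative blinfun_apply (g' x)) (at x)"
    "\<And>x. x \<in> X \<Longrightarrow> Dx f (x, t) = blinfun_apply (g' x)"
    "\<And>x. x \<in> X \<Longrightarrow> \<exists>B. (g' has_derivative B) (at x) \<and> D2x f (x, t) = (\<lambda>v. blinfun_apply (B v))"
proof -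
  obtain f' :: "'a \<times> real \<Rightarrow> ('a \<times> real) \<Rightarrow>\<^sub>L 'b" and f''
    where f': "\<And>z. z \<in> X \<times> {0<..<T} \<Longrightarrow> (f has_derivative blinfun_apply (f' z)) (at z)"
      and f'': "\<And>z. z \<in> X \<times> {0<..<T} \<Longrightarrow> (f' has_derivative blinfun_apply (f'' z)) (at z)"
    using assms(3) unfolding C2_on_def by blast
  define P :: "'a \<Rightarrow>\<^sub>L ('a \<times> real)" where "P = Blinfun (\<lambda>v. (v, 0))"
  have P: "blinfun_apply P v = (v, 0)" for v
    unfolding P_def by (subst bounded_linear_Blinfun_apply) (auto intro!: bounded_linear_intros)
  define g' where "g' x = f' (x, t) o\<^sub>L P" for x
  have slice: "((\<lambda>y. (y, t)) has_derivative (\<lambda>v. (v, 0))) (at x)" for x :: 'a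
    by (auto intro!: derivative_eq_intros)
  have 1: "((\<lambda>y. f (y, t)) has_derivative blinfun_apply (g' x)) (at x)" if "x \<in> X" for x
    using has_derivative_compose[OF slice f'[of "(x, t)"]] that assms(2)
    by (simp add: g'_def blinfun_compose.rep_eq P o_def)
  have 2: "Dx f (x, t) = blinfun_apply (g' x)" if "x \<in> X" for x
    using frechet_derivative_at[OF 1[OF that]] by (simp add: Dx_def)
  have 3: "\<exists>B. (g' has_derivative B) (at x) \<and> D2x f (x, t) = (\<lambda>v. blinfun_apply (B v))"
    if "x \<in> X" for x
  proof -
    define B where "B v = f'' (x, t) (v, 0) o\<^sub>L P" for v
    have "((\<lambda>y. f' (y, t)) has_derivative (\<lambda>v. f'' (x, t) (v, 0))) (at x)"
      using has_derivative_compose[OF slice f''[of "(x, t)"]] that assms(2) by simp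
    then have B: "(g' has_derivative B) (at x)"
      unfolding g'_def B_def
      by (rule bounded_linear.has_derivative
          [OF bounded_bilinear.bounded_linear_left[OF bounded_bilinear_blinfun_compose]])
    \<comment> \<open>\<open>Dx\<close> is known to agree with \<open>g'\<close> only on
      \<open>X\<close>; openness of \<open>X\<close> makes this enough to transfer the
      derivative.\<close>
    have "((\<lambda>y. Blinfun (Dx f (y, t))) has_derivative B) (at x)"
      using B \<open>open X\<close> that
      by (rule has_derivative_transform_within_open) (simp add: 2 blinfun_apply_inverse)
    then have "frechet_derivative (\<lambda>y. Blinfun (Dx f (y, t))) (at x) = B"
      by (rule frechet_derivative_at[symmetric])
    then show ?thesis
      using B by (auto simp: D2x_def fun_eq_iff)
  qed
  show ?thesis
    using that 1 2 3 by blast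
qed

theorem theorem1p2:
  fixes f :: "(real ^ 'n) \<times> real \<Rightarrow> real ^ 'n"
    and X :: "(real ^ 'n) set"
    and T :: real
  assumes "T > 0"
    and "open X"
    and "C2_on f (X \<times> {0<..<T})"
    and "transversality f X T"
  shows "\<forall>t\<in>{0<..<T}. \<forall>x \<in> zero_slice f X t. x isolated_in zero_slice f X t"
proof (intro ballI)
  fix t x
  assume t: "t \<in> {0<..<T}" and "x \<in> zero_slice f X t"
  then have x: "x \<in> X" "f (x, t) = 0"
    by (auto simp: zero_slice_def)
  obtain g' where g':
    "\<And>y. y \<in> X \<Longrightarrow> ((\<lambda>y. f (y, t)) has_derivative blinfun_apply (g' y)) (at y)"
    "\<And>y. y \<in> X \<Longrightarrow> Dx f (y, t) = blinfun_apply (g' y)"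
    "\<And>y. y \<in> X \<Longrightarrow> \<exists>B. (g' has_derivative B) (at y) \<and> D2x f (y, t) = (\<lambda>v. blinfun_apply (B v))"
    using slice_derivatives[OF assms(2) t assms(3)] by blast
  then obtain B where B: "(g' has_derivative B) (at x)" "D2x f (x, t) = (\<lambda>v. blinfun_apply (B v))"
    using x by blast
  have "blinfun_apply (B v) v \<bullet> w \<noteq> 0"
    if v: "g' x v = 0" "v \<noteq> 0" and w: "\<And>y. g' x y \<bullet> w = 0" "w \<noteq> 0" for v w
  proof -
    \<comment> \<open>The nonzero kernel vector \<open>v\<close> makes \<open>(x, t)\<close> a
      singular point, which is what gives access to (T3).\<close>
    have "\<not> inj (blinfun_apply (g' x))"
      using v by (metis blinfun.zero_right injD)
    then have "(x, t) \<in> singular_set f X T"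
      using x t by (auto simp: singular_set_def zero_set_def g'(2) bij_def)
    then have "transversal_T3 f (x, t)"
      using assms(4) by (auto simp: transversality_def)
    moreover have "v \<in> null_space (Dx f (x, t))"
      using v x by (simp add: null_space_def g'(2))
    \<comment> \<open>Moving the adjoint across the inner product turns orthogonality to the range
      into membership in the kernel of the transpose.\<close>
    moreover have "adjoint (blinfun_apply (g' x)) w \<bullet> y = 0" for y
      using adjoint_clauses(2)[OF bounded_linear.linear[OF blinfun.bounded_linear_right], of "g' x" w y]
        w(1)[of y] by (simp add: inner_commute)
    then have "w \<in> null_space (adjoint (Dx f (x, t)))"
      using x by (metis (mono_tags, lifting) g'(2) inner_eq_zero_iff mem_Collect_eq null_space_def)
    ultimately show ?thesis
      using v(2) w(2) B(2) by (auto simp: transversal_T3_def)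
  qed
  with assms(2) x g'(1) B(1) show "x isolated_in zero_slice f X t"
    unfolding zero_slice_def
    by (rule isolated_zero_if_nondegenerate[where g = "\<lambda>y. f (y, t)" and g' = g' and B = B])
qed

end
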